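(* Let $(A,\mu,\alpha)$ be a Hom-flexible algebra over $\mathbf{k}$ and $A^-=(A,[-,-],\alpha)$ be its commutator Hom-algebra. Then the following statements are equivalent: (1) $A$ is Hom-Maltsev-admissible. (2) $J_{A^-}(\alpha(x),\alpha(y),[x,z])=[J_{A^-}(x,y,z),\alpha^2(x)]$ for all $x,y,z\in A$. (3) $S_A(\alpha(x),\alpha(y),[x,z])=[S_A(x,y,z),\alpha^2(x)]$ for all $x,y,z\in A$. (4) $S_A(\alpha(w),\alpha(y),[x,z])+S_A(\alpha(x),\alpha(y),[w,z])=[S_A(w,y,z),\alpha^2(x)]+[S_A(x,y,z),\alpha^2(w)]$ for all $w,x,y,z\in A$.
   Context: $\mathbf{k}$ is a fixed field of characteristic $0$; all modules, linear maps and tensor products are over $\mathbf{k}$. A Hom-algebra is a triple $(A,\mu,\alpha)$ with $A$ a $\mathbf{k}$-module, $\mu\colon A\otimes A\to A$ bilinear (not necessarily associative or unital), and $\alpha\colon A\to A$ linear with $\alpha(\mu(x,y))=\mu(\alpha(x),\alpha(y))$ for all $x,y$. The Hom-associator is $as_A(x,y,z)=\mu(\mu(x,y),\alpha(z))-\mu(\alpha(x),\mu(y,z))$. $A$ is Hom-flexible if $as_A(x,y,x)=0$ for all $x,y\in A$. The cyclic Hom-associator is $S_A(x,y,z)=as_A(x,y,z)+as_A(z,x,y)+as_A(y,z,x)$. The commutator Hom-algebra of $A$ is $A^-=(A,[-,-],\alpha)$ with $[x,y]=\mu(x,y)-\mu(y,x)$. For a Hom-algebra $(B,[-,-],\alpha)$,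 the Hom-Jacobian is $J_B(x,y,z)=[[x,y],\alpha(z)]+[[z,x],\alpha(y)]+[[y,z],\alpha(x)]$. A Hom-Maltsev algebra is a Hom-algebra $(B,[-,-],\alpha)$ with $[-,-]$ anti-symmetric and $J_B(\alpha(x),\alpha(y),[x,z])=[J_B(x,y,z),\alpha^2(x)]$ for all $x,y,z\in B$. $A$ is Hom-Maltsev-admissible if $A^-$ is a Hom-Maltsev algebra. *)

theory Defs
  imports Complex_Main
begin

(* A Hom-algebra over a field k of characteristic 0 is given by the scalar multiplication
   scale of k on the type 'a, a multiplication \<mu> and a twisting map \<alpha>. A linear map
   A \<otimes> A \<rightarrow> A is rendered in curried form, as a map that is linear in each argument. *)

locale hom_algebra = vector_space scale
  for scale :: "'k::field_char_0 \<Rightarrow> 'a::ab_group_add \<Rightarrow> 'a" +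
  fixes \<mu> :: "'a \<Rightarrow> 'a \<Rightarrow> 'a" and \<alpha> :: "'a \<Rightarrow> 'a"
  assumes linear_mult_right: "\<And>x. Vector_Spaces.linear scale scale (\<lambda>y. \<mu> x y)"
    and linear_mult_left: "\<And>y. Vector_Spaces.linear scale scale (\<lambda>x. \<mu> x y)"
    and linear_twist: "Vector_Spaces.linear scale scale \<alpha>"
    and twist_mult: "\<And>x y. \<alpha> (\<mu> x y) = \<mu> (\<alpha> x) (\<alpha> y)"

definition hom_associator ::
    "('a::ab_group_add \<Rightarrow> 'a \<Rightarrow> 'a) \<Rightarrow> ('a \<Rightarrow> 'a) \<Rightarrow> 'a \<Rightarrow> 'a \<Rightarrow> 'a \<Rightarrow> 'a" where
  "hom_associator \<mu> \<alpha> x y z = \<mu> (\<mu> x y) (\<alpha> z) - \<mu> (\<alpha> x) (\<mu> y z)"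

definition cyclic_hom_associator ::
    "('a::ab_group_add \<Rightarrow> 'a \<Rightarrow> 'a) \<Rightarrow> ('a \<Rightarrow> 'a) \<Rightarrow> 'a \<Rightarrow> 'a \<Rightarrow> 'a \<Rightarrow> 'a" where
  "cyclic_hom_associator \<mu> \<alpha> x y z =
     hom_associator \<mu> \<alpha> x y z + hom_associator \<mu> \<alpha> z x y + hom_associator \<mu> \<alpha> y z x"

definition commutator :: "('a::ab_group_add \<Rightarrow> 'a \<Rightarrow> 'a) \<Rightarrow> 'a \<Rightarrow> 'a \<Rightarrow> 'a" where
  "commutator \<mu> x y = \<mu> x y - \<mu> y x"

definition hom_jacobian ::
    "('a::ab_group_add \<Rightarrow> 'a \<Rightarrow> 'a) \<Rightarrow> ('a \<Rightarrow> 'a) \<Rightarrow> 'a \<Rightarrow> 'a \<Rightarrow> 'a \<Rightarrow> 'a" where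
  "hom_jacobian \<beta> \<alpha> x y z = \<beta> (\<beta> x y) (\<alpha> z) + \<beta> (\<beta> z x) (\<alpha> y) + \<beta> (\<beta> y z) (\<alpha> x)"

locale hom_flexible_algebra = hom_algebra +
  assumes flexible: "\<And>x y. hom_associator \<mu> \<alpha> x y x = 0"

locale hom_maltsev_algebra = hom_algebra scale \<beta> \<alpha>
  for scale :: "'k::field_char_0 \<Rightarrow> 'a::ab_group_add \<Rightarrow> 'a"
    and \<beta> :: "'a \<Rightarrow> 'a \<Rightarrow> 'a" and \<alpha> :: "'a \<Rightarrow> 'a" +
  assumes antisymmetric: "\<And>x y. \<beta> x y = - \<beta> y x"
    and hom_maltsev_identity: "\<And>x y z.
      hom_jacobian \<beta> \<alpha> (\<alpha> x) (\<alpha> y) (\<beta> x z) = \<beta> (hom_jacobian \<beta> \<alpha> x y z) (\<alpha> (\<alpha> x))"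

definition hom_maltsev_admissible ::
    "('k::field_char_0 \<Rightarrow> 'a::ab_group_add \<Rightarrow> 'a) \<Rightarrow> ('a \<Rightarrow> 'a \<Rightarrow> 'a) \<Rightarrow> ('a \<Rightarrow> 'a) \<Rightarrow> bool" where
  "hom_maltsev_admissible scale \<mu> \<alpha> \<longleftrightarrow> hom_maltsev_algebra scale (commutator \<mu>) \<alpha>"

end

theory Submission
  imports Defs
begin

text \<open>
  Two elementary facts make the four conditions equivalent. Flexibility says that the
  Hom-associator vanishes when its outer arguments agree; polarising, it changes sign when the
  outer arguments are exchanged. Hence the cyclic sum \<open>S\<close> is skew-symmetric in its first two
  arguments. In every Hom-algebra the Hom-Jacobian of the commutator is
  \<open>J x y z = S x y z - S y x z\<close>, so here \<open>J = 2 S\<close>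
  (\<open>jacobian_eq_twice_cyclic\<close>). Both sides of the Hom-Maltsev identity are additive in \<open>J\<close>,
  and the underlying group has no 2-torsion because the ground field has characteristic 0;
  cancelling the factor 2 turns the identity for \<open>J\<close> into the identity for \<open>S\<close>.

  The identity for \<open>S\<close> is quadratic in \<open>x\<close>: it says that, for fixed \<open>y\<close> and \<open>z\<close>, the biadditive
  map taking \<open>w\<close> and \<open>x\<close> to \<open>S (\<alpha> w) (\<alpha> y) [x, z] - [S w y z, \<alpha>\<^sup>2 x]\<close> is alternating. Without
  2-torsion this is the same as being skew-symmetric (\<open>alternating_iff_skew\<close>), which is the
  four-variable identity.

  Finally, the commutator always makes \<open>A\<close> a Hom-algebra with an anti-symmetric product, so
  Hom-Maltsev-admissibility is no more than the Hom-Maltsev identity itself.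
\<close>

text \<open>
  The usual polarisation argument, in the generality that serves both for the Hom-associator and
  for the defect of the Hom-Maltsev identity.
\<close>

lemma alternating_iff_skew:
  fixes B :: "'a::ab_group_add \<Rightarrow> 'a \<Rightarrow> 'b::ab_group_add"
  assumes add_left: "\<And>x x' y. B (x + x') y = B x y + B x' y"
    and add_right: "\<And>x y y'. B x (y + y') = B x y + B x y'"
    and no_2_torsion: "\<And>v :: 'b. v + v = 0 \<Longrightarrow> v = 0"
  shows "(\<forall>x. B x x = 0) \<longleftrightarrow> (\<forall>x y. B x y + B y x = 0)"
proof
  assume alt: "\<forall>x. B x x = 0"
  show "\<forall>x y. B x y + B y x = 0"
  proof (intro allI)
    fix x y
    have "B (x + y) (x + y) = B x x + B y x + (B x y + B y y)"
      by (simp only: add_left add_right)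
    with alt show "B x y + B y x = 0"
      by (simp add: add.commute)
  qed
qed (use no_2_torsion in blast)

context hom_algebra
begin

lemma mult_add_left: "\<mu> (x + x') y = \<mu> x y + \<mu> x' y"
  using linear_mult_left by (simp add: Vector_Spaces.linear_iff)

lemma mult_add_right: "\<mu> x (y + y') = \<mu> x y + \<mu> x y'"
  using linear_mult_right by (simp add: Vector_Spaces.linear_iff)

lemma twist_add: "\<alpha> (x + y) = \<alpha> x + \<alpha> y"
  using linear_twist by (simp add: Vector_Spaces.linear_iff)

lemma mult_diff_left: "\<mu> (x - x') y = \<mu> x y - \<mu> x' y"
  using mult_add_left[of "x - x'" x' y] by (simp add: algebra_simps)

lemma mult_diff_right: "\<mu> x (y - y') = \<mu> x y - \<mu> x y'"
  using mult_add_right[of x "y - y'" y'] by (simp add: algebra_simps)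

lemma twist_diff: "\<alpha> (x - y) = \<alpha> x - \<alpha> y"
  using twist_add[of "x - y" y] by (simp add: algebra_simps)

lemma no_2_torsion:
  fixes v :: 'a
  assumes "v + v = 0"
  shows "v = 0"
proof -
  have "scale 2 v = v + v"
    using scale_left_distrib[of 1 1 v] by simp
  with assms show ?thesis
    by simp
qed

lemma double_cancel:
  fixes u v :: 'a
  shows "u + u = v + v \<longleftrightarrow> u = v"
proof
  assume "u + u = v + v"
  then have "(u - v) + (u - v) = 0"
    by (simp add: algebra_simps)
  then show "u = v"
    using no_2_torsion[of "u - v"] by simp
qed simp

lemma commutator_add_left:
  "commutator \<mu> (x + x') y = commutator \<mu> x y + commutator \<mu> x' y"
  by (simp add: commutator_def mult_add_left mult_add_right)

lemma commutator_add_right: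
  "commutator \<mu> x (y + y') = commutator \<mu> x y + commutator \<mu> x y'"
  by (simp add: commutator_def mult_add_left mult_add_right)

lemma associator_add:
  "hom_associator \<mu> \<alpha> (x + x') y z = hom_associator \<mu> \<alpha> x y z + hom_associator \<mu> \<alpha> x' y z"
  "hom_associator \<mu> \<alpha> x (y + y') z = hom_associator \<mu> \<alpha> x y z + hom_associator \<mu> \<alpha> x y' z"
  "hom_associator \<mu> \<alpha> x y (z + z') = hom_associator \<mu> \<alpha> x y z + hom_associator \<mu> \<alpha> x y z'"
  by (simp_all add: hom_associator_def mult_add_left mult_add_right twist_add)

lemma cyclic_associator_add_first:
  "cyclic_hom_associator \<mu> \<alpha> (x + x') y z =
     cyclic_hom_associator \<mu> \<alpha> x y z + cyclic_hom_associator \<mu> \<alpha> x' y z"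
  by (simp add: cyclic_hom_associator_def associator_add)

lemma cyclic_associator_add_third:
  "cyclic_hom_associator \<mu> \<alpha> x y (z + z') =
     cyclic_hom_associator \<mu> \<alpha> x y z + cyclic_hom_associator \<mu> \<alpha> x y z'"
  by (simp add: cyclic_hom_associator_def associator_add)

text \<open>
  Expanding the double commutators gives twelve products, and the Hom-associators in the six
  orders of the arguments, signed by parity, contain exactly these.
\<close>

lemma jacobian_eq_cyclic_diff:
  "hom_jacobian (commutator \<mu>) \<alpha> x y z =
     cyclic_hom_associator \<mu> \<alpha> x y z - cyclic_hom_associator \<mu> \<alpha> y x z"
  by (simp add: hom_jacobian_def cyclic_hom_associator_def hom_associator_def commutator_def
      mult_diff_left mult_diff_right)

lemma hom_algebra_commutator: "hom_algebra scale (commutator \<mu>) \<alpha>"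
proof -
  have scale_left: "\<mu> (scale c x) y = scale c (\<mu> x y)" for c x y
    using linear_mult_left by (simp add: Vector_Spaces.linear_iff)
  have scale_right: "\<mu> x (scale c y) = scale c (\<mu> x y)" for c x y
    using linear_mult_right by (simp add: Vector_Spaces.linear_iff)
  have twist: "\<alpha> (commutator \<mu> x y) = commutator \<mu> (\<alpha> x) (\<alpha> y)" for x y
    by (simp add: commutator_def twist_diff twist_mult)
  show ?thesis
  proof (intro hom_algebra.intro hom_algebra_axioms.intro)
    show "Vector_Spaces.linear scale scale (\<lambda>y. commutator \<mu> x y)" for x
      using vector_space_axioms
      by (simp add: Vector_Spaces.linear_iff commutator_add_right)
        (simp add: commutator_def scale_left scale_right scale_right_diff_distrib)
    show "Vector_Spaces.linear scale scale (\<lambda>x. commutator \<mu> x y)" for y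
      using vector_space_axioms
      by (simp add: Vector_Spaces.linear_iff commutator_add_left)
        (simp add: commutator_def scale_left scale_right scale_right_diff_distrib)
  qed (use vector_space_axioms linear_twist twist in auto)
qed

lemma maltsev_admissible_iff_maltsev_identity:
  "hom_maltsev_admissible scale \<mu> \<alpha> \<longleftrightarrow>
     (\<forall>x y z. hom_jacobian (commutator \<mu>) \<alpha> (\<alpha> x) (\<alpha> y) (commutator \<mu> x z) =
        commutator \<mu> (hom_jacobian (commutator \<mu>) \<alpha> x y z) (\<alpha> (\<alpha> x)))"
proof -
  have "\<forall>x y. commutator \<mu> x y = - commutator \<mu> y x"
    by (simp add: commutator_def)
  with hom_algebra_commutator show ?thesis
    unfolding hom_maltsev_admissible_def hom_maltsev_algebra_def hom_maltsev_algebra_axioms_def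
    by blast
qed

lemma cyclic_maltsev_identity_iff_linearised:
  fixes S br
  defines "S \<equiv> cyclic_hom_associator \<mu> \<alpha>" and "br \<equiv> commutator \<mu>"
  shows "(\<forall>x. S (\<alpha> x) (\<alpha> y) (br x z) = br (S x y z) (\<alpha> (\<alpha> x))) \<longleftrightarrow>
    (\<forall>w x. S (\<alpha> w) (\<alpha> y) (br x z) + S (\<alpha> x) (\<alpha> y) (br w z) =
       br (S w y z) (\<alpha> (\<alpha> x)) + br (S x y z) (\<alpha> (\<alpha> w)))"
proof -
  let ?B = "\<lambda>w x. S (\<alpha> w) (\<alpha> y) (br x z) - br (S w y z) (\<alpha> (\<alpha> x))"
  have "(\<forall>x. ?B x x = 0) \<longleftrightarrow> (\<forall>w x. ?B w x + ?B x w = 0)"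
    by (rule alternating_iff_skew[where B = ?B])
      (auto simp: S_def br_def twist_add commutator_add_left commutator_add_right
        cyclic_associator_add_first cyclic_associator_add_third intro: no_2_torsion)
  moreover have "?B w x + ?B x w = 0 \<longleftrightarrow>
      S (\<alpha> w) (\<alpha> y) (br x z) + S (\<alpha> x) (\<alpha> y) (br w z) =
        br (S w y z) (\<alpha> (\<alpha> x)) + br (S x y z) (\<alpha> (\<alpha> w))" for w x
    by (simp only: add_diff_add[symmetric] right_minus_eq)
  ultimately show ?thesis
    by simp
qed

end

context hom_flexible_algebra
begin

lemma associator_skew: "hom_associator \<mu> \<alpha> z y x = - hom_associator \<mu> \<alpha> x y z"
proof -
  have "(\<forall>x. hom_associator \<mu> \<alpha> x y x = 0) \<longleftrightarrow>
      (\<forall>x z. hom_associator \<mu> \<alpha> x y z + hom_associator \<mu> \<alpha> z y x = 0)"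
    by (rule alternating_iff_skew[where B = "\<lambda>x z. hom_associator \<mu> \<alpha> x y z"])
      (auto simp: associator_add intro: no_2_torsion)
  with flexible have "hom_associator \<mu> \<alpha> z y x + hom_associator \<mu> \<alpha> x y z = 0"
    by blast
  then show ?thesis
    by (simp only: eq_neg_iff_add_eq_0)
qed

text \<open>
  Exchanging the first two arguments of the cyclic sum permutes its three terms and reverses
  each of them.
\<close>

lemma cyclic_associator_skew:
  "cyclic_hom_associator \<mu> \<alpha> y x z = - cyclic_hom_associator \<mu> \<alpha> x y z"
  using associator_skew[of y x z] associator_skew[of z y x] associator_skew[of x z y]
  by (simp add: cyclic_hom_associator_def)

lemma jacobian_eq_twice_cyclic:
  "hom_jacobian (commutator \<mu>) \<alpha> x y z =
     cyclic_hom_associator \<mu> \<alpha> x y z + cyclic_hom_associator \<mu> \<alpha> x y z"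
  by (simp add: jacobian_eq_cyclic_diff cyclic_associator_skew[of y x z])

end

theorem proposition4p3:
  fixes scale :: "'k::field_char_0 \<Rightarrow> 'a::ab_group_add \<Rightarrow> 'a"
    and \<mu> :: "'a \<Rightarrow> 'a \<Rightarrow> 'a" and \<alpha> :: "'a \<Rightarrow> 'a"
  assumes "hom_flexible_algebra scale \<mu> \<alpha>"
  defines "br \<equiv> commutator \<mu>"
    and "J \<equiv> hom_jacobian (commutator \<mu>) \<alpha>"
    and "S \<equiv> cyclic_hom_associator \<mu> \<alpha>"
  shows "(hom_maltsev_admissible scale \<mu> \<alpha>
            \<longleftrightarrow> (\<forall>x y z. J (\<alpha> x) (\<alpha> y) (br x z) = br (J x y z) (\<alpha> (\<alpha> x))))
       \<and> ((\<forall>x y z. J (\<alpha> x) (\<alpha> y) (br x z) = br (J x y z) (\<alpha> (\<alpha> x)))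
            \<longleftrightarrow> (\<forall>x y z. S (\<alpha> x) (\<alpha> y) (br x z) = br (S x y z) (\<alpha> (\<alpha> x))))
       \<and> ((\<forall>x y z. S (\<alpha> x) (\<alpha> y) (br x z) = br (S x y z) (\<alpha> (\<alpha> x)))
            \<longleftrightarrow> (\<forall>w x y z. S (\<alpha> w) (\<alpha> y) (br x z) + S (\<alpha> x) (\<alpha> y) (br w z)
                   = br (S w y z) (\<alpha> (\<alpha> x)) + br (S x y z) (\<alpha> (\<alpha> w))))"
proof -
  interpret hom_flexible_algebra scale \<mu> \<alpha>
    by fact
  have jacobian_iff_cyclic: "J (\<alpha> x) (\<alpha> y) (br x z) = br (J x y z) (\<alpha> (\<alpha> x)) \<longleftrightarrow>
      S (\<alpha> x) (\<alpha> y) (br x z) = br (S x y z) (\<alpha> (\<alpha> x))" for x y z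
    by (simp add: J_def S_def br_def jacobian_eq_twice_cyclic commutator_add_left double_cancel)
  have "hom_maltsev_admissible scale \<mu> \<alpha> \<longleftrightarrow>
      (\<forall>x y z. J (\<alpha> x) (\<alpha> y) (br x z) = br (J x y z) (\<alpha> (\<alpha> x)))"
    unfolding J_def br_def by (rule maltsev_admissible_iff_maltsev_identity)
  moreover have "(\<forall>x y z. S (\<alpha> x) (\<alpha> y) (br x z) = br (S x y z) (\<alpha> (\<alpha> x))) \<longleftrightarrow>
      (\<forall>w x y z. S (\<alpha> w) (\<alpha> y) (br x z) + S (\<alpha> x) (\<alpha> y) (br w z) =
         br (S w y z) (\<alpha> (\<alpha> x)) + br (S x y z) (\<alpha> (\<alpha> w)))"
    unfolding S_def br_def using cyclic_maltsev_identity_iff_linearised by metis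
  ultimately show ?thesis
    by (simp only: jacobian_iff_cyclic)
qed

end
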